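(* For every integer $d\geq 2$, there is a constant $\beta=\beta(d)>0$ such that every set $S\subseteq\mathbb{R}^d$ with $\operatorname{b}_d(S)$ defined satisfies $\operatorname{b}_d(S)\leq\beta\,\operatorname{c}(S)$.
   Context: $\lambda_k$ denotes $k$-dimensional Lebesgue measure; "measurable" means Lebesgue measurable; $\operatorname{Conv}$ denotes convex hull. For $1\leq k\leq d$ and $S\subseteq\mathbb{R}^d$ let $\operatorname{Simp}_k(S)=\{(A_0,\dots,A_k)\in S^{k+1}:\operatorname{Conv}(\{A_0,\dots,A_k\})\subseteq S\}\subseteq(\mathbb{R}^d)^{k+1}$. The $k$-index of convexity is $\operatorname{b}_k(S)=\lambda_{(k+1)d}(\operatorname{Simp}_k(S))/\lambda_d(S)^{k+1}$; it is defined if and only if $S$ is measurable with finite positive measure and $\operatorname{Simp}_k(S)$ is measurable. The convexity ratio is $\operatorname{c}(S)=\operatorname{smc}(S)/\lambda_d(S)$, where $\operatorname{smc}(S)$ is the supremum of the measures of convex subsets of $S$ (all convex subsets of $\mathbb{R}^d$ are measurable). *)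

theory Defs
  imports "HOL-Analysis.Analysis"
begin

text \<open>
  A tuple \<open>(A 0, \<dots>, A k)\<close> of points is an extensional function on \<open>{..k}\<close>. Lebesgue measure
  on the space of these tuples is the completion of the product of the Borel-Lebesgue measures
  of the factors. The completion matters: it is taken after the product, so its measurable sets
  are the Lebesgue measurable ones, which a product of copies of \<open>lebesgue\<close> would not give.
\<close>

definition lebesgue_tuples :: "nat \<Rightarrow> (nat \<Rightarrow> 'a::euclidean_space) measure" where
  "lebesgue_tuples k = completion (\<Pi>\<^sub>M i\<in>{..k}. lborel)"

definition Simp :: "nat \<Rightarrow> 'a::euclidean_space set \<Rightarrow> (nat \<Rightarrow> 'a) set" where
  "Simp k S = {A \<in> {..k} \<rightarrow>\<^sub>E S. convex hull (A ` {..k}) \<subseteq> S}"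

definition convexity_index_defined :: "nat \<Rightarrow> 'a::euclidean_space set \<Rightarrow> bool" where
  "convexity_index_defined k S \<longleftrightarrow>
     S \<in> sets lebesgue \<and> 0 < emeasure lebesgue S \<and> emeasure lebesgue S < \<infinity> \<and>
     Simp k S \<in> sets (lebesgue_tuples k)"

text \<open>Meaningful only under \<^const>\<open>convexity_index_defined\<close>.\<close>

definition convexity_index :: "nat \<Rightarrow> 'a::euclidean_space set \<Rightarrow> real" where
  "convexity_index k S =
     measure (lebesgue_tuples k) (Simp k S) / measure lebesgue S ^ (k + 1)"

text \<open>
  The supremum is taken in the extended reals, so it is correct for every set. Convex subsets of a
  Euclidean space are always Lebesgue measurable, so no measurability condition is imposed.
\<close>

definition smc :: "'a::euclidean_space set \<Rightarrow> ennreal" where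
  "smc S = (SUP C\<in>{C. convex C \<and> C \<subseteq> S}. emeasure lebesgue C)"

text \<open>For measurable \<open>S\<close>, \<open>smc S\<close> is at most the measure of \<open>S\<close>; so if that is
  finite, \<^const>\<open>enn2real\<close> loses nothing.\<close>

definition convexity_ratio :: "'a::euclidean_space set \<Rightarrow> real" where
  "convexity_ratio S = enn2real (smc S) / measure lebesgue S"

end

theory Submission imports Defs begin

text \<open>
  Write \<open>d\<close> for the dimension. The idea is that, in a simplex contained in \<open>S\<close>, some vertex is
  confined by the other \<open>d\<close> vertices to a set whose volume is at most a constant times
  \<^term>\<open>smc S\<close>. Integrating over the other \<open>d\<close> vertices, which lie in \<open>S\<close>, bounds the measure of
  \<^term>\<open>Simp d S\<close> by a constant times \<open>smc S * \<lambda>(S)^d\<close>, and division by \<open>\<lambda>(S)^(d+1)\<close> gives the theorem.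

  To see the confinement, fix a nonzero vector \<open>e\<close> once and for all. For a nondegenerate simplex with
  vertices \<open>A 0, \<dots>, A d\<close> the edges \<open>x k = A k - A 0\<close> form a basis, so
  \<open>e = \<Sum>k. c k * x k\<close>. Choose \<open>i\<close> with \<open>\<bar>c i\<bar>\<close> maximal. Then
  \<open>x i\<close> is the combination of \<open>e\<close> with coefficient \<open>1 / c i\<close> and of the other edges
  with coefficients \<open>- c k / c i\<close>, which lie in \<open>[-1, 1]\<close>. By Cramer's rule \<open>1 / c i\<close> is
  \<open>det (x 1, \<dots>, x d) / D\<close>, where \<open>D\<close> is the determinant with \<open>e\<close> in place of \<open>x i\<close>, a number
  determined by the other vertices. Now \<open>\<bar>det (x 1, \<dots>, x d)\<bar>\<close> is \<open>d!\<close> times the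
  volume of the simplex, which is a convex subset of \<open>S\<close>, hence it is at most
  \<open>B = d! * smc S\<close>. So \<open>x i\<close> lies in the image of the box with half-widths
  \<open>1, \<dots>, 1, B / \<bar>D\<bar>\<close> under a linear map of determinant \<open>D\<close>, and this image has volume
  \<open>2^d * B\<close> (lemma \<open>emeasure_row_box_le\<close>). There are \<open>d\<close> choices of \<open>i\<close>, which leads to the constant
  \<open>d * 2^d * d!\<close>.

  Two technical points remain: degenerate simplices form a null set
  (lemma \<open>degenerate_tuples_null\<close>), and \<open>S\<close> is replaced by a Borel hull so that
  Fubini's theorem applies to Borel sets (lemma \<open>emeasure_Simp_le\<close>).
\<close>

section \<open>Linear images of compact sets over an arbitrary finite index type\<close>

text \<open>
  Both sides of the volume formula \<open>measure_linear_image\<close> are unchanged when the coordinates are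
  renamed along a bijection. The formula for a well-ordered index type therefore gives it for every
  finite index type, once each finite type has a well-ordered copy; an initial segment of the naturals
  provides one.
\<close>

typedef ('n::finite) index = "{..<CARD('n)}"
  by (rule exI[of _ 0]) simp

setup_lifting type_definition_index

instantiation index :: (finite) wellorder
begin
lift_definition less_eq_index :: "'a index \<Rightarrow> 'a index \<Rightarrow> bool" is "(\<le>)" .
lift_definition less_index :: "'a index \<Rightarrow> 'a index \<Rightarrow> bool" is "(<)" .
instance
proof
  fix P :: "'a index \<Rightarrow> bool" and a
  assume step: "\<And>x. (\<And>y. y < x \<Longrightarrow> P y) \<Longrightarrow> P x"
  show "P a"
    by (induction a rule: measure_induct_rule[where f = Rep_index])
      (rule step, simp add: less_index.rep_eq)
qed (transfer, force)+
end

lemma Rep_index_bij: "bij_betw Rep_index (UNIV :: 'n::finite index set) {..<CARD('n)}"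
  using type_definition.Rep_range[OF type_definition_index]
  by (auto simp: bij_betw_def inj_on_def Rep_index_inject)

instance index :: (finite) finite
proof
  show "finite (UNIV :: 'a index set)"
    using bij_betw_finite[OF Rep_index_bij] by simp
qed

lemma ex_bij_index: "\<exists>g :: 'n::finite index \<Rightarrow> 'n. bij g"
proof -
  have "card (UNIV :: 'n index set) = CARD('n)"
    using bij_betw_same_card[OF Rep_index_bij] by simp
  then show ?thesis
    by (rule finite_same_card_bij[OF finite_class.finite_UNIV finite_class.finite_UNIV])
qed

lemma det_reindex:
  fixes A :: "'a::comm_ring_1^'n^'n" and g :: "'m::finite \<Rightarrow> 'n"
  assumes "bij g"
  shows "det (\<chi> i j. A $ g i $ g j) = det A"
proof -
  have inj: "inj g" and inv: "bij (inv g)" and [simp]: "\<And>y. g (inv g y) = y" "\<And>x. inv g (g x) = x"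
    using assms by (auto simp: bij_is_inj bij_is_surj surj_f_inv_f bij_imp_bij_inv)
  let ?F = "map_permutation UNIV g"
  have perm: "?F p permutes UNIV" if "p permutes UNIV" for p
    using map_permutation_permutes[OF assms that] .
  have app: "?F p (g x) = g (p x)" for p x
    by (rule map_permutation_apply) (use inj in auto)
  have comp: "map_permutation UNIV (inv g) (?F p) = p" if "p permutes UNIV" for p
    using assms inv that by (intro map_permutation_compose_inv[of g UNIV UNIV]) auto
  have comp': "?F (map_permutation UNIV (inv g) p) = p" if "p permutes UNIV" for p
    using assms inv that by (intro map_permutation_compose_inv[of "inv g" UNIV UNIV]) auto
  have "det A = (\<Sum>p | p permutes (UNIV :: 'm set).
      of_int (sign (?F p)) * (\<Prod>i\<in>UNIV. A $ i $ ?F p i))"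
    unfolding det_def
    by (rule sum.reindex_bij_witness[of _ ?F "map_permutation UNIV (inv g)"])
      (use perm map_permutation_permutes[OF inv] comp comp' in auto)
  also have "\<dots> = (\<Sum>p | p permutes (UNIV :: 'm set).
      of_int (sign p) * (\<Prod>i\<in>UNIV. A $ g i $ g (p i)))"
  proof (rule sum.cong[OF refl])
    fix p :: "'m \<Rightarrow> 'm" assume "p \<in> {p. p permutes UNIV}"
    then have "sign (?F p) = sign p"
      using inj by (intro sign_map_permutation) auto
    moreover have "(\<Prod>i\<in>UNIV. A $ i $ ?F p i) = (\<Prod>i\<in>UNIV. A $ g i $ ?F p (g i))"
      using assms by (intro prod.reindex_bij_betw[symmetric]) auto
    ultimately show "of_int (sign (?F p)) * (\<Prod>i\<in>UNIV. A $ i $ ?F p i) =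
        of_int (sign p) * (\<Prod>i\<in>UNIV. A $ g i $ g (p i))"
      by (simp add: app)
  qed
  also have "\<dots> = det (\<chi> i j. A $ g i $ g j)"
    by (simp add: det_def)
  finally show ?thesis by simp
qed

lemma lborel_reindex:
  fixes g :: "'m::finite \<Rightarrow> 'n::finite"
  assumes "bij g"
  shows "distr lborel borel (\<lambda>x :: real^'n. \<chi> i. x $ g i) = lborel"
proof (rule lborel_eqI[symmetric])
  let ?f = "\<lambda>x :: real^'n. \<chi> i. x $ g i"
  have [measurable]: "?f \<in> borel_measurable borel"
    by (intro borel_measurable_continuous_onI continuous_intros)
  fix l u :: "real^'m"
  assume le: "\<And>b. b \<in> Basis \<Longrightarrow> l \<bullet> b \<le> u \<bullet> b"
  have le': "l $ i \<le> u $ i" for i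
    using le[of "axis i 1"] by (simp add: inner_axis)
  let ?h = "\<lambda>x :: real^'m. \<chi> i. x $ inv g i"
  have "?f -` box l u = box (?h l) (?h u)"
    using assms by (auto simp: mem_box_cart bij_is_inj bij_is_surj surj_f_inv_f) 
      (metis bij_inv_eq_iff)+
  then have "emeasure (distr lborel borel ?f) (box l u) = emeasure lborel (box (?h l) (?h u))"
    by (simp add: emeasure_distr)
  also have "\<dots> = (\<Prod>b\<in>Basis. (?h u - ?h l) \<bullet> b)"
    using le' by (intro emeasure_lborel_box) (auto simp: Basis_vec_def inner_axis)
  also have "(\<Prod>b\<in>Basis. (?h u - ?h l) \<bullet> b) = (\<Prod>i\<in>UNIV. u $ inv g i - l $ inv g i)"
    by (simp add: Basis_vec_def prod.UNION_disjoint inner_axis axis_eq_axis)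
  also have "\<dots> = (\<Prod>i\<in>UNIV. u $ i - l $ i)"
    using assms by (intro prod.reindex_bij_betw bij_imp_bij_inv)
  also have "\<dots> = (\<Prod>b\<in>Basis. (u - l) \<bullet> b)"
    by (simp add: Basis_vec_def prod.UNION_disjoint inner_axis axis_eq_axis)
  finally show "emeasure (distr lborel borel ?f) (box l u) = (\<Prod>b\<in>Basis. (u - l) \<bullet> b)" .
qed simp

lemma emeasure_lborel_matrix_image:
  fixes A :: "real^'n::finite^'n"
  assumes "compact S"
  shows "emeasure lborel ((*v) A ` S) = ennreal \<bar>det A\<bar> * emeasure lborel S"
proof -
  obtain g :: "'n index \<Rightarrow> 'n" where g: "bij g"
    using ex_bij_index by blast
  then have [simp]: "g (inv g y) = y" "inv g (g x) = x" for x y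
    by (auto simp: bij_is_inj bij_is_surj surj_f_inv_f)
  define f :: "real^'n \<Rightarrow> real^'n index" where "f = (\<lambda>x. \<chi> i. x $ g i)"
  define f' :: "real^'n index \<Rightarrow> real^'n" where "f' = (\<lambda>x. \<chi> i. x $ inv g i)"
  have ff': "f (f' x) = x" "f' (f y) = y" for x y
    by (auto simp: f_def f'_def)
  define A' :: "real^'n index^'n index" where "A' = (\<chi> i j. A $ g i $ g j)"
  have conj: "f (A *v x) = A' *v f x" for x
    using sum.reindex_bij_betw[OF g, of "\<lambda>j. A $ g i $ j * x $ j" for i]
    by (simp add: f_def A'_def matrix_vector_mult_def vec_eq_iff)
  have cont: "continuous_on T f" for T
    unfolding f_def by (intro continuous_intros)
  have cont': "f' \<in> borel_measurable borel"
    unfolding f'_def by (intro borel_measurable_continuous_onI continuous_intros)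
  have vol: "emeasure lborel (f ` T) = emeasure lborel T" if "compact T" for T
  proof -
    have T: "T \<in> sets borel"
      using that by (intro borel_closed compact_imp_closed)
    have "f ` T = f' -` T"
      by (force simp: ff' image_iff)
    then have "emeasure lborel (f ` T) = emeasure (distr lborel borel f') T"
      using T cont' by (simp add: emeasure_distr)
    also have "distr lborel borel f' = lborel"
      unfolding f'_def by (rule lborel_reindex) (rule bij_imp_bij_inv[OF g])
    finally show ?thesis .
  qed
  have S': "compact (f ` S)" "compact ((*v) A' ` f ` S)" "compact ((*v) A ` S)"
    using assms
    by (auto intro!: compact_continuous_image cont linear_continuous_on
        simp: linear_conv_bounded_linear[symmetric])
  have lm: "emeasure lborel T = ennreal (measure lebesgue T)" if "compact T" for T :: "(real^'n index) set"
    using emeasure_eq_measure2[OF lmeasurable_compact[OF that]] that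
    by (simp add: borel_compact)
  have "emeasure lborel ((*v) A ` S) = emeasure lborel (f ` (*v) A ` S)"
    using vol[OF S'(3)] by simp
  also have "f ` (*v) A ` S = (*v) A' ` f ` S"
    by (auto simp: image_image conj)
  also have "emeasure lborel \<dots> = ennreal (measure lebesgue ((*v) A' ` f ` S))"
    by (rule lm) fact
  also have "measure lebesgue ((*v) A' ` f ` S) = \<bar>det A'\<bar> * measure lebesgue (f ` S)"
    using measure_linear_image[OF matrix_vector_mul_linear lmeasurable_compact[OF S'(1)]] by simp
  also have "ennreal \<dots> = ennreal \<bar>det A'\<bar> * emeasure lborel (f ` S)"
    using lm[OF S'(1)] by (simp add: ennreal_mult)
  also have "det A' = det A"
    unfolding A'_def by (rule det_reindex[OF g])
  finally show ?thesis
    using vol[OF assms] by simp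
qed

section \<open>Bounding a set of tuples through its slices\<close>

text \<open>
  Fubini in the form in which the proof uses it: integrate over the \<open>i\<close>-th point first. With
  \<open>c = 0\<close> and \<open>T = UNIV\<close> it says that a set with null slices is null, since
  \<open>0 * \<infinity> = 0\<close> in \<^typ>\<open>ennreal\<close>. Only slices through points of \<open>E\<close> have to be bounded, so the slice
  bound may use whatever is known about a tuple in \<open>E\<close>.
\<close>

lemma emeasure_PiM_slices_le:
  fixes T :: "'a::euclidean_space set"
  assumes I: "finite I" "i \<in> I"
    and E: "E \<in> sets (\<Pi>\<^sub>M j\<in>I. lborel)" and T: "T \<in> sets borel"
    and others: "\<And>A j. A \<in> E \<Longrightarrow> j \<in> I \<Longrightarrow> j \<noteq> i \<Longrightarrow> A j \<in> T"
    and slice: "\<And>A. A \<in> E \<Longrightarrow> emeasure lborel {y. A(i := y) \<in> E} \<le> c"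
  shows "emeasure (\<Pi>\<^sub>M j\<in>I. lborel) E \<le> c * emeasure lborel T ^ (card I - 1)"
proof -
  interpret product_sigma_finite "\<lambda>_ :: 'b. lborel :: 'a measure" ..
  define J where "J = I - {i}"
  have J: "finite J" "i \<notin> J" "I = insert i J" "card J = card I - 1"
    using I by (auto simp: J_def)
  have E': "E \<in> sets (\<Pi>\<^sub>M j\<in>insert i J. lborel)"
    using E J(3) by simp
  have meas: "Pi\<^sub>E J (\<lambda>_. T) \<in> sets (\<Pi>\<^sub>M j\<in>J. lborel)"
    using J(1) T by (intro sets_PiM_I_finite) auto
  have "emeasure (\<Pi>\<^sub>M j\<in>I. lborel) E = (\<integral>\<^sup>+A. indicator E A \<partial>(\<Pi>\<^sub>M j\<in>insert i J. lborel))"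
    using E' J(3) by simp
  also have "\<dots> = (\<integral>\<^sup>+x. (\<integral>\<^sup>+y. indicator E (x(i := y)) \<partial>lborel) \<partial>(\<Pi>\<^sub>M j\<in>J. lborel))"
    using E' by (intro product_nn_integral_insert J) simp
  also have "\<dots> \<le> (\<integral>\<^sup>+x. c * indicator (Pi\<^sub>E J (\<lambda>_. T)) x \<partial>(\<Pi>\<^sub>M j\<in>J. lborel))"
  proof (rule nn_integral_mono)
    fix x :: "'b \<Rightarrow> 'a"
    assume x: "x \<in> space (\<Pi>\<^sub>M j\<in>J. lborel)"
    have "(\<lambda>y. x(i := y)) \<in> lborel \<rightarrow>\<^sub>M (\<Pi>\<^sub>M j\<in>insert i J. lborel)"
      using x J(2) by (rule measurable_component_update)
    from measurable_sets[OF this E'] have "{y. x(i := y) \<in> E} \<in> sets lborel"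
      by (simp add: vimage_def)
    moreover have "(\<lambda>y. indicator E (x(i := y)) :: ennreal) = indicator {y. x(i := y) \<in> E}"
      by (auto simp: indicator_def)
    ultimately have eq: "(\<integral>\<^sup>+y. indicator E (x(i := y)) \<partial>lborel) = emeasure lborel {y. x(i := y) \<in> E}"
      by simp
    show "(\<integral>\<^sup>+y. indicator E (x(i := y)) \<partial>lborel) \<le> c * indicator (Pi\<^sub>E J (\<lambda>_. T)) x"
    proof (cases "\<exists>y. x(i := y) \<in> E")
      case True
      then obtain y where y: "x(i := y) \<in> E" by blast
      have "x j \<in> T" if "j \<in> J" for j
        using others[OF y, of j] that J by auto
      then have "x \<in> Pi\<^sub>E J (\<lambda>_. T)"
        using x by (auto simp: space_PiM PiE_def)
      then show ?thesis
        using slice[OF y] by (simp add: eq)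
    next
      case False
      then show ?thesis by simp
    qed
  qed
  also have "\<dots> = c * emeasure (\<Pi>\<^sub>M j\<in>J. lborel) (Pi\<^sub>E J (\<lambda>_. T))"
    using meas by (rule nn_integral_cmult_indicator)
  also have "emeasure (\<Pi>\<^sub>M j\<in>J. lborel) (Pi\<^sub>E J (\<lambda>_. T)) = emeasure lborel T ^ (card I - 1)"
    using J T by (subst emeasure_PiM) auto
  finally show ?thesis .
qed

section \<open>Where one row of a matrix can lie\<close>

lemma emeasure_lborel_translation:
  fixes K :: "'a::euclidean_space set"
  assumes "K \<in> sets borel"
  shows "emeasure lborel ((+) a ` K) = emeasure lborel K"
proof -
  have "(+) a ` K = (+) (- a) -` K"
  proof
    show "(+) (- a) -` K \<subseteq> (+) a ` K"
      by (rule subsetI, rule_tac x = "- a + x" in image_eqI) auto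
  qed auto
  also have "emeasure lborel \<dots> = emeasure (distr lborel borel ((+) (- a))) K"
    using assms by (simp add: emeasure_distr)
  finally show ?thesis
    by (simp only: lborel_distr_plus)
qed

definition replace_row :: "'a^'n^'m \<Rightarrow> 'm \<Rightarrow> 'a^'n \<Rightarrow> 'a^'n^'m" where
  "replace_row M i v = (\<chi> j. if j = i then v else M $ j)"

lemma replace_row_twice [simp]: "replace_row (replace_row M i v) i w = replace_row M i w"
  by (simp add: replace_row_def vec_eq_iff)

text \<open>
  The geometric core. Let \<open>N\<close> be the matrix with \<open>y - a\<close> as row \<open>i\<close>, and write \<open>e\<close> as
  \<open>\<Sum>k. c k * row k N\<close>. By Cramer's rule, \<open>c k\<close> is the determinant of \<open>N\<close> with row \<open>k\<close>
  replaced by \<open>e\<close>, divided by \<open>det N\<close>; so the hypothesis on these determinants says that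
  \<open>\<bar>c i\<bar>\<close> is maximal. Solving for row \<open>i\<close> expresses \<open>y - a\<close> through \<open>e\<close> and the other
  rows, with coefficients \<open>- c k / c i\<close> of absolute value at most \<open>1\<close> and coefficient
  \<open>1 / c i = det N / D\<close> at \<open>e\<close>, where \<open>D\<close> is the determinant of \<open>M\<close> with row \<open>i\<close> replaced by \<open>e\<close>.
  Thus \<open>y - a\<close> ranges over the linear image of a box of volume \<open>2^n * B / \<bar>D\<bar>\<close> under a map of
  determinant \<open>D\<close>, and \<open>D\<close> cancels.

  The statement is for all subsets \<open>R\<close> of the region, so that it applies to slices without
  a separate proof that the region is measurable.
\<close>

lemma emeasure_row_box_le:
  fixes M :: "real^'n::finite^'n" and a e :: "real^'n"
  assumes e: "e \<noteq> 0" and "0 \<le> B"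
    and R: "R \<subseteq> {y. det (replace_row M i (y - a)) \<noteq> 0 \<and> \<bar>det (replace_row M i (y - a))\<bar> \<le> B \<and>
      (\<forall>k. \<bar>det (replace_row (replace_row M i (y - a)) k e)\<bar> \<le> \<bar>det (replace_row M i e)\<bar>)}"
  shows "emeasure lborel R \<le> ennreal (2 ^ CARD('n) * B)"
proof -
  define L where "L = replace_row M i e"
  define D where "D = det L"
  define u :: "real^'n" where "u = (\<chi> k. if k = i then B / \<bar>D\<bar> else 1)"
  have box: "D \<noteq> 0 \<and> y - a \<in> (*v) (transpose L) ` cbox (-u) u" if "y \<in> R" for y
  proof -
    define N where "N = replace_row M i (y - a)"
    from that R have N: "det N \<noteq> 0" "\<bar>det N\<bar> \<le> B" "\<And>k. \<bar>det (replace_row N k e)\<bar> \<le> \<bar>D\<bar>"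
      by (auto simp: N_def D_def L_def)
    have rowL: "row k L = (if k = i then e else row k N)" for k
      by (simp add: L_def N_def replace_row_def row_def vec_eq_iff)
    have rowi: "row i N = y - a"
      by (simp add: N_def replace_row_def row_def vec_eq_iff)
    obtain c where c: "transpose N *v c = e"
      using N(1) cramer[of "transpose N"] by (auto simp: det_transpose)
    have sum_rows: "transpose X *v x = (\<Sum>k\<in>UNIV. x $ k *s row k X)" for X :: "real^'n^'n" and x
      by (simp add: matrix_mult_sum)
    have cramer: "det (replace_row N k e) = c $ k * det N" for k
    proof -
      have "replace_row N k e = (\<chi> j. if j = k then \<Sum>i\<in>UNIV. c $ i *s row i N else row j N)"
        using c unfolding sum_rows by (simp add: replace_row_def row_def vec_eq_iff)
      then show ?thesis using cramer_lemma_transpose[of k c N] by simp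
    qed
    have D: "D = c $ i * det N"
      using cramer[of i] by (simp add: D_def L_def N_def)
    have c_le: "\<bar>c $ k\<bar> \<le> \<bar>c $ i\<bar>" for k
      using N(3)[of k] N(1) by (simp add: cramer D abs_mult)
    have ci: "c $ i \<noteq> 0"
    proof
      assume "c $ i = 0"
      with c_le have "c = 0" by (simp add: vec_eq_iff)
      with c e show False by simp
    qed
    \<comment> \<open>The coefficients obtained by solving \<open>e = \<Sum>k. c k * row k N\<close> for row \<open>i\<close>.\<close>
    define w :: "real^'n" where "w = (\<chi> k. if k = i then 1 / c $ i else - c $ k / c $ i)"
    have "transpose L *v w = w $ i *s row i L + (\<Sum>k\<in>UNIV - {i}. w $ k *s row k L)"
      unfolding sum_rows by (rule sum.remove) auto
    also have "\<dots> = (1 / c $ i) *s (e - (\<Sum>k\<in>UNIV - {i}. c $ k *s row k N))"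
      by (simp add: w_def rowL vec_eq_iff sum_divide_distrib sum_negf[symmetric] diff_divide_distrib cong: if_cong)
    also have "e = c $ i *s row i N + (\<Sum>k\<in>UNIV - {i}. c $ k *s row k N)"
      unfolding c[symmetric] sum_rows by (rule sum.remove) auto
    finally have "transpose L *v w = y - a"
      using ci by (simp add: rowi vec_eq_iff)
    moreover have "w \<in> cbox (-u) u"
    proof -
      have "\<bar>w $ k\<bar> \<le> u $ k" for k
        using c_le[of k] ci N(1,2) by (auto simp: w_def u_def D abs_mult divide_simps)
      then show ?thesis
        by (simp add: mem_box_cart abs_le_iff minus_le_iff)
    qed
    ultimately have "y - a \<in> (*v) (transpose L) ` cbox (-u) u"
      by (intro image_eqI[of _ _ w]) simp_all
    then show ?thesis
      using ci N(1) D by simp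
  qed
  show ?thesis
  proof (cases "D = 0")
    case True
    with box have "R = {}" by blast
    then show ?thesis by (simp only: emeasure_empty zero_le)
  next
    case False
    let ?K = "(*v) (transpose L) ` cbox (-u) u"
    have K: "compact ?K"
      by (intro compact_continuous_image compact_cbox linear_continuous_on)
        (simp add: linear_conv_bounded_linear[symmetric])
    have pos: "0 \<le> u $ k" for k
      using \<open>0 \<le> B\<close> by (simp add: u_def)
    have "R \<subseteq> (+) a ` ?K"
    proof
      fix y assume "y \<in> R"
      with box have "y - a \<in> ?K" by blast
      then show "y \<in> (+) a ` ?K"
        by (rule rev_image_eqI) simp
    qed
    then have "emeasure lborel R \<le> emeasure lborel ((+) a ` ?K)"
      using K by (intro emeasure_mono) (auto intro!: borel_compact compact_translation)
    also have "\<dots> = emeasure lborel ?K"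
      using K by (intro emeasure_lborel_translation borel_compact)
    also have "\<dots> = ennreal \<bar>D\<bar> * emeasure lborel (cbox (-u) u)"
      by (simp add: emeasure_lborel_matrix_image D_def det_transpose del: transpose_matrix_vector)
    also have "emeasure lborel (cbox (-u) u) = ennreal (\<Prod>k\<in>UNIV. 2 * u $ k)"
      using pos by (simp add: emeasure_lborel_cbox_eq Basis_vec_def inner_axis prod.UNION_disjoint
          axis_eq_axis minus_le_iff)
    also have "(\<Prod>k\<in>UNIV. 2 * u $ k) = 2 ^ CARD('n) * (B / \<bar>D\<bar>)"
      by (simp add: prod.distrib u_def)
    also have "ennreal \<bar>D\<bar> * ennreal (2 ^ CARD('n) * (B / \<bar>D\<bar>)) = ennreal (2 ^ CARD('n) * B)"
      using False \<open>0 \<le> B\<close> by (simp add: ennreal_mult[symmetric])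
    finally show ?thesis .
  qed
qed

text \<open>
  As a function of row \<open>i\<close> the determinant is a linear functional; it does not vanish at \<open>e\<close>,
  so its zeros form a hyperplane.
\<close>

lemma emeasure_degenerate_row:
  fixes M :: "real^'n::finite^'n"
  assumes "det (replace_row M i e) \<noteq> 0"
    and R: "R \<subseteq> {y. det (replace_row M i (y - a)) = 0}"
  shows "emeasure lborel R = 0"
proof -
  define w :: "real^'n" where "w = (\<chi> j. det (replace_row M i (axis j 1)))"
  have w: "det (replace_row M i v) = w \<bullet> v" for v
  proof -
    have "replace_row M i v = (\<chi> k. if k = i then \<Sum>j\<in>UNIV. v $ j *s axis j 1 else M $ k)"
      by (simp only: replace_row_def basis_expansion)
    then have "det (replace_row M i v) =
        (\<Sum>j\<in>UNIV. det (\<chi> k. if k = i then v $ j *s axis j 1 else M $ k))"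
      by (simp only: det_linear_row_sum[OF finite_class.finite_UNIV])
    also have "\<dots> = (\<Sum>j\<in>UNIV. v $ j * det (replace_row M i (axis j 1)))"
      unfolding replace_row_def by (simp only: det_row_mul)
    finally show ?thesis
      by (simp add: w_def inner_vec_def mult.commute)
  qed
  have eq: "{y. det (replace_row M i (y - a)) = 0} = {y. w \<bullet> y = w \<bullet> a}"
    by (simp add: w inner_diff_right)
  have "w \<noteq> 0"
    using assms by (auto simp: w)
  then have "negligible {y. w \<bullet> y = w \<bullet> a}"
    by (simp add: negligible_hyperplane)
  moreover have H: "{y. w \<bullet> y = w \<bullet> a} \<in> sets borel"
    by (intro borel_closed closed_hyperplane)
  ultimately have "emeasure lborel {y. w \<bullet> y = w \<bullet> a} = 0"
    by (simp add: negligible_iff_emeasure0)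
  then show ?thesis
    using emeasure_mono[of R "{y. w \<bullet> y = w \<bullet> a}" lborel] R H by (simp add: eq)
qed

section \<open>Simplices\<close>

text \<open>The simplex is an affine image of the standard simplex, whose volume is \<open>1 / n!\<close>.\<close>

lemma emeasure_simplex:
  fixes x :: "'n::finite \<Rightarrow> real^'n"
  shows "emeasure lborel (convex hull (insert a (range x))) =
    ennreal (\<bar>det (\<chi> i. x i - a)\<bar> / fact CARD('n))"
proof -
  define M where "M = (\<chi> i. x i - a)"
  let ?S = "convex hull (insert 0 Basis) :: (real^'n) set"
  let ?K = "(*v) (transpose M) ` ?S"
  have S: "compact ?S"
    by (intro finite_imp_compact_convex_hull) simp
  have K: "compact ?K"
    by (intro compact_continuous_image S linear_continuous_on)
      (simp add: linear_conv_bounded_linear[symmetric])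
  have Basis: "(Basis :: (real^'n) set) = range (\<lambda>i. axis i 1)"
    by (auto simp: Basis_vec_def)
  have col: "transpose M *v axis i 1 = x i - a" for i
    by (simp add: matrix_vector_mult_basis M_def column_def transpose_def vec_eq_iff)
  have "insert a (range x) = (+) a ` (*v) (transpose M) ` insert 0 Basis"
    by (simp add: Basis image_image col del: transpose_matrix_vector)
  then have "convex hull (insert a (range x)) = (+) a ` ?K"
    by (simp only: convex_hull_translation convex_hull_linear_image[OF matrix_vector_mul_linear])
  also have "emeasure lborel \<dots> = emeasure lborel ?K"
    using K by (intro emeasure_lborel_translation borel_compact)
  also have "\<dots> = ennreal \<bar>det M\<bar> * ennreal (1 / fact CARD('n))"
    by (simp add: emeasure_lborel_matrix_image[OF S] emeasure_std_simplex det_transpose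
        del: transpose_matrix_vector)
  also have "\<dots> = ennreal (\<bar>det M\<bar> / fact CARD('n))"
    by (simp add: ennreal_mult[symmetric])
  finally show ?thesis
    by (simp add: M_def)
qed

text \<open>
  The vertices of a \<open>d\<close>-simplex are numbered by naturals and the rows of a matrix by \<open>'n\<close>; \<open>h\<close>
  matches the rows with the vertices other than the base vertex \<open>0\<close>.
\<close>

definition edge_matrix :: "('n::finite \<Rightarrow> nat) \<Rightarrow> (nat \<Rightarrow> real^'n) \<Rightarrow> real^'n^'n" where
  "edge_matrix h A = (\<chi> i. A (h i) - A 0)"

lemma edge_matrix_upd:
  assumes "inj h" "h i \<noteq> 0"
  shows "edge_matrix h (A(h i := y)) = replace_row (edge_matrix h A) i (y - A 0)"
  using assms by (auto simp: edge_matrix_def replace_row_def vec_eq_iff inj_eq)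

lemma borel_measurable_det:
  fixes X :: "'b \<Rightarrow> real^'n::finite^'n"
  assumes "\<And>i j. (\<lambda>A. X A $ i $ j) \<in> borel_measurable P"
  shows "(\<lambda>A. det (X A)) \<in> borel_measurable P"
  unfolding det_def using assms by measurable

lemma borel_measurable_tuple_component:
  assumes "k \<in> I"
  shows "(\<lambda>A :: 'i \<Rightarrow> real^'n::finite. A k $ j) \<in> borel_measurable (\<Pi>\<^sub>M j\<in>I. lborel)"
proof -
  have "(\<lambda>A :: 'i \<Rightarrow> real^'n::finite. A k) \<in> borel_measurable (\<Pi>\<^sub>M j\<in>I. lborel)"
    using measurable_component_singleton[OF assms, of "\<lambda>_. lborel :: (real^'n) measure"] by simp
  moreover have "(\<lambda>x :: real^'n. x $ j) \<in> borel_measurable borel"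
    by (intro borel_measurable_continuous_onI continuous_intros)
  ultimately show ?thesis
    by (rule measurable_compose)
qed

text \<open>
  Degenerate tuples form a null set, but this does not follow from a single slice: if the other
  points are already in special position, then a slice in one point may be the whole space.
  Therefore the edges are put in one after the other, starting from the identity matrix. If the
  determinant with the rows in \<open>K\<close> filled in is nonzero, then it vanishes after filling in
  row \<open>k\<close> only on a hyperplane of values of that row.
\<close>

lemma degenerate_tuples_null:
  fixes h :: "'n::finite \<Rightarrow> nat"
  assumes I: "finite I" "0 \<in> I" and h: "inj h" "\<And>i. h i \<in> I" "\<And>i. h i \<noteq> 0"
  shows "{A \<in> space (\<Pi>\<^sub>M j\<in>I. lborel). det (edge_matrix h A) = 0} \<in> null_sets (\<Pi>\<^sub>M j\<in>I. lborel)"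
proof -
  let ?P = "\<Pi>\<^sub>M j\<in>I. lborel :: (real^'n) measure"
  define X :: "'n set \<Rightarrow> (nat \<Rightarrow> real^'n) \<Rightarrow> real^'n^'n"
    where "X = (\<lambda>K A. \<chi> i. if i \<in> K then A (h i) - A 0 else axis i 1)"
  have meas [measurable]: "(\<lambda>A. det (X K A)) \<in> borel_measurable ?P" for K
  proof (rule borel_measurable_det)
    fix i j
    have [measurable]: "(\<lambda>A. A (h i) $ j) \<in> borel_measurable ?P" "(\<lambda>A. A 0 $ j) \<in> borel_measurable ?P"
      using I h by (auto intro: borel_measurable_tuple_component)
    show "(\<lambda>A. X K A $ i $ j) \<in> borel_measurable ?P"
      by (cases "i \<in> K") (simp_all add: X_def)
  qed
  have "{A \<in> space ?P. det (X K A) = 0} \<in> null_sets ?P" if "finite K" for K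
    using that
  proof (induction K rule: finite_induct)
    case empty
    have "X {} A = mat 1" for A
      by (simp add: X_def vec_eq_iff axis_def mat_def)
    then show ?case by simp
  next
    case (insert k K)
    let ?N = "{A \<in> space ?P. det (X K A) = 0}"
    let ?E = "{A \<in> space ?P. det (X K A) \<noteq> 0 \<and> det (X (insert k K) A) = 0}"
    have upd: "X (insert k K) (A(h k := y)) = replace_row (X K A) k (y - A 0)"
      and K: "X K A = replace_row (X K A) k (axis k 1)" for A y
      using insert(2) h(1) h(3)[of k] by (auto simp: X_def replace_row_def vec_eq_iff inj_eq)
    have E: "?E \<in> sets ?P" by measurable
    have "emeasure ?P ?E \<le> 0 * emeasure lborel (UNIV :: (real^'n) set) ^ (card I - 1)"
    proof (rule emeasure_PiM_slices_le[OF I(1) h(2) E])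
      fix A assume A: "A \<in> ?E"
      then have "det (replace_row (X K A) k (axis k 1)) \<noteq> 0"
        using K[of A] by simp
      then have "emeasure lborel {y. A(h k := y) \<in> ?E} = 0"
        by (rule emeasure_degenerate_row[where a = "A 0"]) (auto simp: upd)
      then show "emeasure lborel {y. A(h k := y) \<in> ?E} \<le> 0" by simp
    qed auto
    then have "?E \<in> null_sets ?P"
      using E by (auto simp: null_sets_def)
    then have "?N \<union> ?E \<in> null_sets ?P"
      using insert.IH by (intro null_sets.Un) auto
    then show ?case
      by (rule null_sets_subset) auto
  qed
  from this[of UNIV] show ?thesis
    by (simp add: X_def edge_matrix_def)
qed

section \<open>The measure of the set of simplices\<close>

text \<open>
  The tuples for which edge \<open>i\<close> has the largest coefficient in the expansion of \<open>e\<close>: once the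
  other points are fixed, the end point of that edge is confined to a set of volume
  \<open>2^n * B\<close>.
\<close>

lemma emeasure_dominated_tuples_le:
  fixes h :: "'n::finite \<Rightarrow> nat" and T :: "(real^'n) set" and e :: "real^'n"
  assumes I: "finite I" "0 \<in> I" and h: "inj h" "\<And>i. h i \<in> I" "\<And>i. h i \<noteq> 0"
    and T: "T \<in> sets borel" and e: "e \<noteq> 0" and B: "0 \<le> B"
  defines "E \<equiv> \<lambda>i. {A \<in> space (\<Pi>\<^sub>M j\<in>I. lborel). A \<in> Pi\<^sub>E I (\<lambda>_. T) \<and>
    det (edge_matrix h A) \<noteq> 0 \<and> \<bar>det (edge_matrix h A)\<bar> \<le> B \<and>
    (\<forall>k. \<bar>det (replace_row (edge_matrix h A) k e)\<bar> \<le> \<bar>det (replace_row (edge_matrix h A) i e)\<bar>)}"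
  shows "E i \<in> sets (\<Pi>\<^sub>M j\<in>I. lborel)"
    and "emeasure (\<Pi>\<^sub>M j\<in>I. lborel) (E i) \<le> ennreal (2 ^ CARD('n) * B) * emeasure lborel T ^ (card I - 1)"
proof -
  let ?P = "\<Pi>\<^sub>M j\<in>I. lborel :: (real^'n) measure"
  have comp [measurable]: "(\<lambda>A. edge_matrix h A $ k $ j) \<in> borel_measurable ?P" for k j
  proof -
    have [measurable]: "(\<lambda>A. A (h k) $ j) \<in> borel_measurable ?P" "(\<lambda>A. A 0 $ j) \<in> borel_measurable ?P"
      using I h by (auto intro: borel_measurable_tuple_component)
    show ?thesis
      by (simp add: edge_matrix_def)
  qed
  have [measurable]: "(\<lambda>A. det (edge_matrix h A)) \<in> borel_measurable ?P"
    by (intro borel_measurable_det comp)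
  have [measurable]: "(\<lambda>A. det (replace_row (edge_matrix h A) k e)) \<in> borel_measurable ?P" for k
  proof (rule borel_measurable_det)
    fix l j
    show "(\<lambda>A. replace_row (edge_matrix h A) k e $ l $ j) \<in> borel_measurable ?P"
      by (cases "l = k") (simp_all add: replace_row_def)
  qed
  have PiE: "Pi\<^sub>E I (\<lambda>_. T) \<in> sets ?P"
    using I T by (intro sets_PiM_I_finite) auto
  show E: "E i \<in> sets ?P"
  proof -
    have *: "{A \<in> space P. f A \<noteq> 0 \<and> \<bar>f A\<bar> \<le> B \<and> (\<forall>k. \<bar>g k A\<bar> \<le> \<bar>g i A\<bar>)} \<in> sets P"
      if [measurable]: "f \<in> borel_measurable P" "\<And>k. g k \<in> borel_measurable P"
      for f :: "(nat \<Rightarrow> real^'n) \<Rightarrow> real" and g :: "'n \<Rightarrow> (nat \<Rightarrow> real^'n) \<Rightarrow> real" and P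
    proof -
      have "Measurable.pred P (\<lambda>A. \<forall>k\<in>UNIV. \<bar>g k A\<bar> \<le> \<bar>g i A\<bar>)"
        unfolding pred_def
        by (intro pred_intros_finite[unfolded pred_def] finite_class.finite_UNIV
            borel_measurable_le borel_measurable_abs that(2))
      then have [measurable]: "Measurable.pred P (\<lambda>A. \<forall>k. \<bar>g k A\<bar> \<le> \<bar>g i A\<bar>)"
        by simp
      show ?thesis by measurable
    qed
    have "{A \<in> space ?P. det (edge_matrix h A) \<noteq> 0 \<and> \<bar>det (edge_matrix h A)\<bar> \<le> B \<and>
        (\<forall>k. \<bar>det (replace_row (edge_matrix h A) k e)\<bar> \<le> \<bar>det (replace_row (edge_matrix h A) i e)\<bar>)} \<in> sets ?P"
      (is "?Q \<in> _") by (rule *) measurable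
    then have "Pi\<^sub>E I (\<lambda>_. T) \<inter> ?Q \<in> sets ?P"
      by (intro sets.Int PiE)
    also have "Pi\<^sub>E I (\<lambda>_. T) \<inter> ?Q = E i"
      by (auto simp: E_def)
    finally show ?thesis .
  qed
  show "emeasure ?P (E i) \<le> ennreal (2 ^ CARD('n) * B) * emeasure lborel T ^ (card I - 1)"
  proof (rule emeasure_PiM_slices_le[OF I(1) h(2)[of i] E T])
    fix A assume "A \<in> E i"
    let ?M = "edge_matrix h A"
    show "emeasure lborel {y. A(h i := y) \<in> E i} \<le> ennreal (2 ^ CARD('n) * B)"
      by (rule emeasure_row_box_le[OF e B, of _ ?M i "A 0"])
        (auto simp: E_def edge_matrix_upd[OF h(1,3)])
  qed (auto simp: E_def PiE_def)
qed

lemma ex_bij_pos_vertices: "\<exists>h :: 'n::finite \<Rightarrow> nat. inj h \<and> range h = {1..CARD('n)}"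
proof -
  obtain h :: "'n \<Rightarrow> nat" where "bij_betw h UNIV {1..CARD('n)}"
    using finite_same_card_bij[of "UNIV :: 'n set" "{1..CARD('n)}"] by auto
  then show ?thesis
    by (auto simp: bij_betw_def)
qed

text \<open>The simplex itself is a convex subset of \<open>S\<close>, which bounds its volume by \<^term>\<open>smc S\<close>.\<close>

lemma abs_det_edge_matrix_le:
  fixes S :: "(real^'n::finite) set"
  assumes h: "range h = {1..CARD('n)}" and A: "A \<in> Simp CARD('n) S" and fin: "smc S < \<infinity>"
  shows "\<bar>det (edge_matrix h A)\<bar> \<le> fact CARD('n) * enn2real (smc S)"
proof -
  have "A ` {..CARD('n)} = insert (A 0) (range (\<lambda>i. A (h i)))"
  proof -
    have "{..CARD('n)} = insert 0 (range h)"
      unfolding h by auto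
    then show ?thesis by (simp add: image_image)
  qed
  then have sub: "convex hull (insert (A 0) (range (\<lambda>i. A (h i)))) \<subseteq> S" (is "?C \<subseteq> S")
    using A by (simp add: Simp_def)
  have "compact ?C"
    by (intro finite_imp_compact_convex_hull) simp
  then have "ennreal (\<bar>det (edge_matrix h A)\<bar> / fact CARD('n)) = emeasure lebesgue ?C"
    by (simp add: emeasure_simplex edge_matrix_def borel_compact)
  also have "\<dots> \<le> smc S"
    unfolding smc_def using sub by (intro SUP_upper) simp
  also have "\<dots> = ennreal (enn2real (smc S))"
    using fin by simp
  finally have "\<bar>det (edge_matrix h A)\<bar> / fact CARD('n) \<le> enn2real (smc S)"
    by (simp del: ennreal_enn2real)
  then show ?thesis
    by (simp add: divide_simps mult.commute)
qed

text \<open>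
  Every nondegenerate simplex in \<open>S\<close> has some edge with the largest coefficient, so \<open>n\<close> sets of
  the above kind and a null set cover all of them.
\<close>

lemma emeasure_Simp_le:
  fixes S :: "(real^'n::finite) set"
  assumes S: "S \<in> sets lebesgue" and fin: "smc S < \<infinity>"
  shows "emeasure (lebesgue_tuples CARD('n)) (Simp CARD('n) S) \<le>
    ennreal (CARD('n) * (2 ^ CARD('n) * (fact CARD('n) * enn2real (smc S)))) * emeasure lebesgue S ^ CARD('n)"
proof -
  define d where "d = CARD('n)"
  let ?P = "\<Pi>\<^sub>M j\<in>{..d}. lborel :: (real^'n) measure"
  define B where "B = fact d * enn2real (smc S)"
  obtain h :: "'n \<Rightarrow> nat" where h: "inj h" "range h = {1..d}"
    using ex_bij_pos_vertices by (auto simp: d_def)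
  then have h': "h i \<in> {..d}" "h i \<noteq> 0" for i
    using rangeI[of h i] by auto
  \<comment> \<open>A Borel hull of \<open>S\<close> makes the covering sets measurable in the product of Borel measures,
    where Fubini applies.\<close>
  obtain T where T: "T \<in> sets borel" "S \<subseteq> T" "emeasure lebesgue S = emeasure lborel T"
    using completion_upper[OF S] by auto
  \<comment> \<open>Any fixed nonzero vector serves as the reference direction.\<close>
  define e :: "real^'n" where "e = axis undefined 1"
  have e: "e \<noteq> 0"
    by (simp add: e_def axis_eq_0_iff)
  have B: "0 \<le> B" by (simp add: B_def)
  define E where "E i = {A \<in> space ?P. A \<in> Pi\<^sub>E {..d} (\<lambda>_. T) \<and>
    det (edge_matrix h A) \<noteq> 0 \<and> \<bar>det (edge_matrix h A)\<bar> \<le> B \<and>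
    (\<forall>k. \<bar>det (replace_row (edge_matrix h A) k e)\<bar> \<le> \<bar>det (replace_row (edge_matrix h A) i e)\<bar>)}" for i
  have E: "E i \<in> sets ?P" "emeasure ?P (E i) \<le> ennreal (2 ^ d * B) * emeasure lborel T ^ d" for i
    using emeasure_dominated_tuples_le[OF _ _ h(1) h' T(1) e B, of i] by (simp_all add: E_def d_def)
  define N where "N = {A \<in> space ?P. det (edge_matrix h A) = 0}"
  have N: "N \<in> null_sets ?P"
    unfolding N_def by (rule degenerate_tuples_null[OF _ _ h(1) h']) auto
  have cover: "Simp d S \<subseteq> N \<union> (\<Union>i. E i)"
  proof
    fix A assume A: "A \<in> Simp d S"
    have AT: "A \<in> Pi\<^sub>E {..d} (\<lambda>_. T)"
      using A T(2) by (auto simp: Simp_def PiE_def)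
    then have space: "A \<in> space ?P"
      by (auto simp: space_PiM PiE_def)
    define f where "f k = \<bar>det (replace_row (edge_matrix h A) k e)\<bar>" for k
    have "Max (range f) \<in> range f"
      by (intro Max_in) auto
    then obtain i where i: "Max (range f) = f i"
      by blast
    have "f k \<le> f i" for k
      unfolding i[symmetric] by (intro Max_ge) auto
    moreover have "\<bar>det (edge_matrix h A)\<bar> \<le> B"
      using abs_det_edge_matrix_le[of h A S] h A fin by (simp add: d_def B_def)
    ultimately have "A \<in> E i" if "det (edge_matrix h A) \<noteq> 0"
      using that AT space by (simp add: E_def f_def)
    then show "A \<in> N \<union> (\<Union>i. E i)"
      using space by (auto simp: N_def)
  qed
  have NE: "N \<union> (\<Union>i. E i) \<in> sets ?P"
    using N E(1) by (auto intro!: sets.Un)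
  have "emeasure (lebesgue_tuples d) (Simp d S) \<le> emeasure (lebesgue_tuples d) (N \<union> (\<Union>i. E i))"
    using NE cover by (intro emeasure_mono) (auto simp: lebesgue_tuples_def)
  also have "\<dots> = emeasure ?P (N \<union> (\<Union>i. E i))"
    using NE by (simp add: lebesgue_tuples_def)
  also have "\<dots> = emeasure ?P (\<Union>i. E i)"
    using N E(1) by (subst Un_commute) (intro emeasure_Un_null_set sets.finite_UN, auto)
  also have "\<dots> \<le> (\<Sum>i\<in>UNIV. emeasure ?P (E i))"
    using E(1) by (intro emeasure_subadditive_finite) auto
  also have "\<dots> \<le> (\<Sum>i\<in>(UNIV :: 'n set). ennreal (2 ^ d * B) * emeasure lborel T ^ d)"
    by (intro sum_mono E(2))
  also have "\<dots> = ennreal (d * (2 ^ d * B)) * emeasure lebesgue S ^ d"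
    using B by (simp add: d_def[symmetric] T(3) ennreal_mult mult.assoc ennreal_of_nat_eq_real_of_nat)
  finally show ?thesis
    by (simp add: d_def B_def)
qed

theorem theorem1p5:
  assumes "CARD('n::finite) \<ge> 2"
  shows "\<exists>\<beta>::real. \<beta> > 0 \<and>
    (\<forall>S :: (real ^ 'n) set. convexity_index_defined CARD('n) S \<longrightarrow>
       convexity_index CARD('n) S \<le> \<beta> * convexity_ratio S)"
proof -
  define d where "d = CARD('n)"
  define \<beta> :: real where "\<beta> = d * (2 ^ d * fact d)"
  have "\<beta> > 0"
    by (simp add: \<beta>_def d_def)
  moreover have "convexity_index d S \<le> \<beta> * convexity_ratio S" if "convexity_index_defined d S" for S :: "(real^'n) set"
  proof -
    from that have S: "S \<in> sets lebesgue" "0 < emeasure lebesgue S" "emeasure lebesgue S < \<infinity>"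
      by (auto simp: convexity_index_defined_def)
    define m where "m = measure lebesgue S"
    have m: "emeasure lebesgue S = ennreal m"
      unfolding m_def using S(3) by (intro emeasure_eq_ennreal_measure) (simp only: infinity_ennreal_def less_top)
    have "0 < m"
      using S(2) unfolding m by simp
    have "smc S \<le> emeasure lebesgue S"
      unfolding smc_def using S(1) by (intro SUP_least emeasure_mono) auto
    then have fin: "smc S < \<infinity>"
      using S(3) by (rule le_less_trans)
    have "emeasure (lebesgue_tuples d) (Simp d S) \<le> ennreal (\<beta> * enn2real (smc S)) * ennreal m ^ d"
      using emeasure_Simp_le[OF S(1) fin] by (simp add: d_def \<beta>_def m mult.assoc)
    also have "\<dots> = ennreal (\<beta> * enn2real (smc S) * m ^ d)"
      using \<open>0 < m\<close> \<open>\<beta> > 0\<close> by (simp add: ennreal_mult ennreal_power)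
    finally have "measure (lebesgue_tuples d) (Simp d S) \<le> \<beta> * enn2real (smc S) * m ^ d"
      unfolding measure_def using \<open>0 < m\<close> \<open>\<beta> > 0\<close> by (intro enn2real_leI) auto
    then have "convexity_index d S \<le> \<beta> * enn2real (smc S) * m ^ d / m ^ (d + 1)"
      unfolding convexity_index_def m_def[symmetric] using \<open>0 < m\<close> by (intro divide_right_mono) auto
    also have "\<dots> = \<beta> * convexity_ratio S"
      using \<open>0 < m\<close> by (simp add: convexity_ratio_def m_def[symmetric])
    finally show ?thesis .
  qed
  ultimately show ?thesis
    unfolding d_def by blast
qed

end
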